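(* Four pairwise distinct points $q_1,q_2,q_3,q_4\in\mathbb{H}$ lie on a same (one-dimensional) circle or straight line if, and only if, their cross-ratio $$\mathcal{CR}(q_1,q_2,q_3,q_4):=(q_1-q_3)(q_1-q_4)^{-1}(q_2-q_4)(q_2-q_3)^{-1}$$ is real.
   Context: $\mathbb{H}\cong\mathbb{R}^4$ is the skew field of real quaternions with its Euclidean structure; circles and straight lines are those of $\mathbb{R}^4$. *)

theory Defs
  imports "HOL-Analysis.Analysis"
begin

section \<open>The skew field of real quaternions\<close>

text \<open>\<open>Quat a b c d\<close> stands for \<open>a + b i + c j + d k\<close>.\<close>

datatype quat = Quat (qre: real) (qim1: real) (qim2: real) (qim3: real)

lemma quat_eqI:
  "qre x = qre y \<Longrightarrow> qim1 x = qim1 y \<Longrightarrow> qim2 x = qim2 y \<Longrightarrow> qim3 x = qim3 y \<Longrightarrow> x = y"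
  by (rule quat.expand) simp

lemma quat_eq_iff:
  "x = y \<longleftrightarrow> qre x = qre y \<and> qim1 x = qim1 y \<and> qim2 x = qim2 y \<and> qim3 x = qim3 y"
  by (auto intro: quat_eqI)

instantiation quat :: ab_group_add
begin

definition zero_quat :: quat where "0 = Quat 0 0 0 0"

definition plus_quat :: "quat \<Rightarrow> quat \<Rightarrow> quat" where
  "x + y = Quat (qre x + qre y) (qim1 x + qim1 y) (qim2 x + qim2 y) (qim3 x + qim3 y)"

definition uminus_quat :: "quat \<Rightarrow> quat" where
  "- x = Quat (- qre x) (- qim1 x) (- qim2 x) (- qim3 x)"

definition minus_quat :: "quat \<Rightarrow> quat \<Rightarrow> quat" where
  "x - y = Quat (qre x - qre y) (qim1 x - qim1 y) (qim2 x - qim2 y) (qim3 x - qim3 y)"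

instance
  by standard
    (simp_all add: quat_eq_iff zero_quat_def plus_quat_def uminus_quat_def minus_quat_def)

end

instantiation quat :: ring_1
begin

definition one_quat :: quat where "1 = Quat 1 0 0 0"

text \<open>The bilinear product determined by \<open>i\<^sup>2 = j\<^sup>2 = k\<^sup>2 = ijk = -1\<close>.\<close>

definition times_quat :: "quat \<Rightarrow> quat \<Rightarrow> quat" where
  "x * y = Quat
     (qre x * qre y - qim1 x * qim1 y - qim2 x * qim2 y - qim3 x * qim3 y)
     (qre x * qim1 y + qim1 x * qre y + qim2 x * qim3 y - qim3 x * qim2 y)
     (qre x * qim2 y - qim1 x * qim3 y + qim2 x * qre y + qim3 x * qim1 y)
     (qre x * qim3 y + qim1 x * qim2 y - qim2 x * qim1 y + qim3 x * qre y)"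

instance
  by standard
    (simp_all add: quat_eq_iff zero_quat_def plus_quat_def one_quat_def times_quat_def
      algebra_simps)

end

instantiation quat :: real_algebra_1
begin

definition scaleR_quat :: "real \<Rightarrow> quat \<Rightarrow> quat" where
  "r *\<^sub>R x = Quat (r * qre x) (r * qim1 x) (r * qim2 x) (r * qim3 x)"

instance
  by standard
    (simp_all add: quat_eq_iff plus_quat_def times_quat_def scaleR_quat_def algebra_simps)

end

text \<open>The coordinatewise inner product, so that \<open>{1, i, j, k}\<close> is orthonormal.\<close>

instantiation quat :: real_inner
begin

definition inner_quat :: "quat \<Rightarrow> quat \<Rightarrow> real" where
  "x \<bullet> y = qre x * qre y + qim1 x * qim1 y + qim2 x * qim2 y + qim3 x * qim3 y"

definition norm_quat :: "quat \<Rightarrow> real" where "norm (x::quat) = sqrt (x \<bullet> x)"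

definition sgn_quat :: "quat \<Rightarrow> quat" where "sgn (x::quat) = x /\<^sub>R norm x"

definition dist_quat :: "quat \<Rightarrow> quat \<Rightarrow> real" where "dist (x::quat) y = norm (x - y)"

definition uniformity_quat :: "(quat \<times> quat) filter" where
  "uniformity = (INF e\<in>{0<..}. principal {(x, y). dist x (y::quat) < e})"

definition open_quat :: "quat set \<Rightarrow> bool" where
  "open (U::quat set) \<longleftrightarrow> (\<forall>x\<in>U. eventually (\<lambda>(x', y). x' = x \<longrightarrow> y \<in> U) uniformity)"

instance
proof
  fix x y z :: quat and r :: real and U :: "quat set"
  show "dist x y = norm (x - y)" by (fact dist_quat_def)
  show "sgn x = x /\<^sub>R norm x" by (fact sgn_quat_def)
  show "uniformity = (INF e\<in>{0<..}. principal {(x, y). dist x (y::quat) < e})"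
    by (fact uniformity_quat_def)
  show "open (U::quat set) \<longleftrightarrow> (\<forall>x\<in>U. eventually (\<lambda>(x', y). x' = x \<longrightarrow> y \<in> U) uniformity)"
    by (fact open_quat_def)
  show "x \<bullet> y = y \<bullet> x" by (simp add: inner_quat_def mult.commute)
  show "(x + y) \<bullet> z = x \<bullet> z + y \<bullet> z"
    by (simp add: inner_quat_def plus_quat_def algebra_simps)
  show "(r *\<^sub>R x) \<bullet> y = r * (x \<bullet> y)"
    by (simp add: inner_quat_def scaleR_quat_def algebra_simps)
  show "0 \<le> x \<bullet> x" by (simp add: inner_quat_def)
  show "x \<bullet> x = 0 \<longleftrightarrow> x = 0"
    by (simp add: inner_quat_def zero_quat_def quat_eq_iff add_nonneg_eq_0_iff)
  show "norm x = sqrt (x \<bullet> x)" by (fact norm_quat_def)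
qed

end

instantiation quat :: euclidean_space
begin

definition Basis_quat :: "quat set" where
  "Basis = {Quat 1 0 0 0, Quat 0 1 0 0, Quat 0 0 1 0, Quat 0 0 0 1}"

instance
proof
  fix u v x :: quat
  show "(Basis::quat set) \<noteq> {}" "finite (Basis::quat set)"
    by (simp_all add: Basis_quat_def)
  show "u \<bullet> v = (if u = v then 1 else 0)" if "u \<in> Basis" "v \<in> Basis"
    using that unfolding Basis_quat_def by (elim insertE emptyE; simp add: inner_quat_def)
  show "(\<forall>u\<in>Basis. x \<bullet> u = 0) \<longleftrightarrow> x = 0"
    by (cases x) (simp add: Basis_quat_def inner_quat_def zero_quat_def)
qed

end

lemma DIM_quat [simp]: "DIM(quat) = 4"
  by (simp add: Basis_quat_def)

text \<open>The inverse is the conjugate divided by the squared norm.\<close>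

instantiation quat :: real_normed_div_algebra
begin

definition inverse_quat :: "quat \<Rightarrow> quat" where
  "inverse x = Quat (qre x) (- qim1 x) (- qim2 x) (- qim3 x) /\<^sub>R (x \<bullet> x)"

definition divide_quat :: "quat \<Rightarrow> quat \<Rightarrow> quat" where "(x::quat) div y = x * inverse y"

instance
proof
  fix x y :: quat
  show "x div y = x * inverse y" by (fact divide_quat_def)
  show "inverse (0::quat) = 0"
    by (simp add: inverse_quat_def zero_quat_def scaleR_quat_def)
  define cnj where "cnj q = Quat (qre q) (- qim1 q) (- qim2 q) (- qim3 q)" for q
  have cnj: "cnj q * q = (q \<bullet> q) *\<^sub>R 1" "q * cnj q = (q \<bullet> q) *\<^sub>R 1" for q
    by (simp_all add: cnj_def quat_eq_iff times_quat_def inner_quat_def one_quat_def scaleR_quat_def)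
  show "inverse x * x = 1" "x * inverse x = 1" if "x \<noteq> 0"
    using that by (simp_all add: inverse_quat_def cnj flip: cnj_def)
  have cnj_mult: "cnj (x * y) = cnj y * cnj x"
    by (simp add: cnj_def quat_eq_iff times_quat_def algebra_simps)
  have "((x * y) \<bullet> (x * y)) *\<^sub>R (1::quat) = x * (y * cnj y) * cnj x"
    by (simp only: cnj(2)[of "x * y", symmetric] cnj_mult mult.assoc)
  also have "\<dots> = ((x \<bullet> x) * (y \<bullet> y)) *\<^sub>R 1"
    by (simp add: cnj mult.commute)
  finally have "(x * y) \<bullet> (x * y) = (x \<bullet> x) * (y \<bullet> y)"
    by (simp add: scaleR_quat_def one_quat_def)
  then show "norm (x * y) = norm x * norm y"
    by (simp add: norm_quat_def real_sqrt_mult)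
qed

end

section \<open>Lines, circles and the cross-ratio\<close>

definition is_line :: "'a::euclidean_space set \<Rightarrow> bool" where
  "is_line L \<longleftrightarrow> affine L \<and> aff_dim L = 1"

text \<open>A one-dimensional circle of positive radius \<open>r\<close>, centred at \<open>c\<close>, in the affine plane \<open>P\<close>.\<close>

definition is_circle :: "'a::euclidean_space set \<Rightarrow> bool" where
  "is_circle C \<longleftrightarrow>
     (\<exists>P c r. affine P \<and> aff_dim P = 2 \<and> c \<in> P \<and> 0 < r \<and> C = {x \<in> P. dist c x = r})"

definition cross_ratio :: "quat \<Rightarrow> quat \<Rightarrow> quat \<Rightarrow> quat \<Rightarrow> quat" where
  "cross_ratio q1 q2 q3 q4 =
     (q1 - q3) * inverse (q1 - q4) * (q2 - q4) * inverse (q2 - q3)"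

end

theory Submission
  imports Defs
begin

text \<open>
  Both sides of the equivalence are turned into the collinearity of three points, by the inversion
  \<open>x \<mapsto> x / \<bar>x\<bar>\<^sup>2\<close> centred at \<open>q4\<close>.

  On the geometric side, after translating \<open>q4\<close> to the origin, inversion sends the circles and lines
  through the origin to lines: a circle through \<open>0\<close> with centre \<open>m\<close> is given in its plane by
  \<open>\<bar>x\<bar>\<^sup>2 = 2 (m \<bullet> x)\<close>, which says that the image \<open>y\<close> of \<open>x\<close> satisfies the linear equation
  \<open>m \<bullet> y = 1/2\<close>. Conversely every line in the image arises in this way from a circle, or
  from itself if it contains the origin. So the four points lie on a circle or line iff the
  inversions of \<open>a = q1 - q4\<close>, \<open>b = q2 - q4\<close> and \<open>c = q3 - q4\<close> are collinear
  (\<open>circle_or_line_iff_collinear_inversion\<close>).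

  On the algebraic side, \<open>c - a = c (a\<^sup>-\<^sup>1 - c\<^sup>-\<^sup>1) a\<close>, and likewise for \<open>b\<close>, so the cross-ratio is
  \<open>c (a\<^sup>-\<^sup>1 - c\<^sup>-\<^sup>1) (b\<^sup>-\<^sup>1 - c\<^sup>-\<^sup>1)\<^sup>-\<^sup>1 c\<^sup>-\<^sup>1\<close>. Real numbers are central, so this conjugate is real iff
  \<open>a\<^sup>-\<^sup>1 - c\<^sup>-\<^sup>1\<close> is a real multiple of \<open>b\<^sup>-\<^sup>1 - c\<^sup>-\<^sup>1\<close>, which is to say that the inverses of \<open>a\<close>, \<open>b\<close>
  and \<open>c\<close> are collinear (\<open>cross_ratio_real_iff_collinear_inverses\<close>). Finally, the inverse of a quaternion
  is the conjugate of its inversion, and conjugation is a linear bijection, hence preserves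
  collinearity in both directions.
\<close>

section \<open>Inversion of lines and circles through the origin\<close>

definition inversion :: "'a::real_inner \<Rightarrow> 'a" where
  "inversion x = x /\<^sub>R (x \<bullet> x)"

lemma inversion_inversion [simp]: "inversion (inversion x) = x"
  by (cases "x = 0") (simp_all add: inversion_def)

lemma inversion_mem_subspace: "subspace V \<Longrightarrow> x \<in> V \<Longrightarrow> inversion x \<in> V"
  by (simp add: inversion_def subspace_scale)

text \<open>The linear equation of the inverted sphere.\<close>

lemma dist_eq_norm_iff_inner_inversion:
  fixes m x :: "'a::real_inner"
  assumes "x \<noteq> 0"
  shows "dist m x = norm m \<longleftrightarrow> m \<bullet> inversion x = 1 / 2"
proof -
  have "dist m x = norm m \<longleftrightarrow> (m - x) \<bullet> (m - x) = m \<bullet> m"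
    by (simp add: dist_norm norm_eq)
  also have "\<dots> \<longleftrightarrow> m \<bullet> x = (x \<bullet> x) / 2"
    by (auto simp: inner_diff_left inner_diff_right inner_commute)
  also have "\<dots> \<longleftrightarrow> m \<bullet> inversion x = 1 / 2"
    using assms by (auto simp: inversion_def field_simps)
  finally show ?thesis .
qed

lemma collinear_inversion_line:
  assumes "is_line L" "0 \<in> L"
  shows "collinear (inversion ` L)"
proof -
  have "subspace L" "aff_dim L = 1"
    using assms by (auto simp: is_line_def subspace_affine)
  then have "inversion ` L \<subseteq> L" "collinear L"
    by (auto simp: inversion_mem_subspace collinear_aff_dim)
  then show ?thesis
    using collinear_subset by blast
qed

text \<open>All differences of inverted points lie in the plane of the circle and are orthogonal to its
  centre, a nonzero vector of the plane. Hence they lie in a one-dimensional space.\<close>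

lemma collinear_inversion_circle:
  fixes C :: "'a::euclidean_space set"
  assumes "is_circle C" "0 \<in> C"
  shows "collinear (inversion ` (C - {0}))"
proof -
  obtain P m r where P: "affine P" "aff_dim P = 2" and m: "m \<in> P" and "0 < r"
    and C: "C = {x \<in> P. dist m x = r}"
    using assms(1) unfolding is_circle_def by blast
  have r: "r = norm m" and sub: "subspace P"
    using assms(2) C P(1) by (auto simp: subspace_affine)
  have "m \<noteq> 0" and dim: "dim P = 2"
    using \<open>0 < r\<close> r P(2) sub by (auto simp: aff_dim_subspace)
  let ?Y = "inversion ` (C - {0})"
  have Y: "y \<in> P \<and> m \<bullet> y = 1 / 2" if "y \<in> ?Y" for y
    using that C r sub dist_eq_norm_iff_inner_inversion by (auto simp: inversion_mem_subspace)
  have perp: "x - y \<in> P \<and> m \<bullet> (x - y) = 0" if "x \<in> ?Y" "y \<in> ?Y" for x y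
    using Y[OF that(1)] Y[OF that(2)] sub by (simp add: inner_diff_right subspace_diff)
  show ?thesis
  proof (cases "\<exists>a\<in>?Y. \<exists>b\<in>?Y. a \<noteq> b")
    case True
    then obtain a b where ab: "a \<in> ?Y" "b \<in> ?Y" "a \<noteq> b" by blast
    define u where "u = a - b"
    have u: "u \<in> P" "m \<bullet> u = 0" "u \<noteq> 0"
      using perp[OF ab(1,2)] ab(3) by (simp_all add: u_def)
    have "pairwise orthogonal {m, u}"
      using u(2) by (auto simp: pairwise_def orthogonal_def inner_commute)
    then have "independent {m, u}"
      using \<open>m \<noteq> 0\<close> u(3) by (intro pairwise_orthogonal_independent) auto
    moreover have "m \<noteq> u"
      using u(2) \<open>m \<noteq> 0\<close> by auto
    ultimately have spanP: "P \<subseteq> span {m, u}"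
      using m u(1) dim by (intro card_ge_dim_independent) auto
    have "\<exists>t. x - y = t *\<^sub>R u" if xy: "x \<in> ?Y" "y \<in> ?Y" for x y
    proof -
      have "x - y \<in> span {m, u}"
        using spanP perp[OF xy] by blast
      then obtain s t where st: "x - y - s *\<^sub>R m = t *\<^sub>R u"
        unfolding span_breakdown_eq[of _ m] span_singleton by blast
      then have "m \<bullet> (x - y) - s * (m \<bullet> m) = 0"
        using u(2) by (metis inner_diff_right inner_scaleR_right mult_zero_right)
      then have "s = 0"
        using perp[OF xy] \<open>m \<noteq> 0\<close> by simp
      then show ?thesis using st by auto
    qed
    then show ?thesis unfolding collinear_def by blast
  next
    case False
    then show ?thesis unfolding collinear_def by (metis diff_self scaleR_zero_left)
  qed
qed

text \<open>A line avoiding the origin is the inversion of the circle that has as diameter the segment from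
  the origin to the inversion of the foot of the perpendicular dropped from the origin.
  Two distinct points fix the direction of the line, hence the plane that the circle lies in.\<close>

lemma inversion_collinear_subset_circle_or_line:
  fixes T :: "'a::euclidean_space set"
  assumes "collinear T" and ab: "a \<in> T" "b \<in> T" "a \<noteq> b"
  shows "\<exists>C. (is_circle C \<or> is_line C) \<and> insert 0 (inversion ` T) \<subseteq> C"
proof -
  obtain u where u: "\<And>x y. x \<in> T \<Longrightarrow> y \<in> T \<Longrightarrow> \<exists>t. x - y = t *\<^sub>R u"
    using \<open>collinear T\<close> unfolding collinear_def by blast
  have "u \<noteq> 0"
    using u[OF ab(1,2)] ab(3) by auto
  define foot where "foot = a - ((a \<bullet> u) / (u \<bullet> u)) *\<^sub>R u"
  have perp: "foot \<bullet> u = 0"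
    using \<open>u \<noteq> 0\<close> by (simp add: foot_def inner_diff_left)
  have T: "\<exists>t. y = foot + t *\<^sub>R u" if y: "y \<in> T" for y
  proof -
    obtain t where "y - a = t *\<^sub>R u" using u[OF y ab(1)] by blast
    then have "y = foot + (t + (a \<bullet> u) / (u \<bullet> u)) *\<^sub>R u"
      by (simp add: foot_def algebra_simps)
    then show ?thesis ..
  qed
  show ?thesis
  proof (cases "foot = 0")
    case True
    have "is_line (span {u})"
      using \<open>u \<noteq> 0\<close> by (simp add: is_line_def subspace_imp_affine aff_dim_subspace dim_span)
    moreover have "inversion ` T \<subseteq> span {u}"
    proof (intro image_subsetI inversion_mem_subspace)
      fix y assume "y \<in> T"
      then show "y \<in> span {u}"
        using T[of y] True by (auto simp: span_singleton)
    qed (rule subspace_span)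
    ultimately show ?thesis by (auto simp: span_zero)
  next
    case False
    define P where "P = span {foot, u}"
    define m where "m = (1 / 2) *\<^sub>R inversion foot"
    have subP: "subspace P" by (simp add: P_def)
    have "foot \<in> P" "u \<in> P" by (simp_all add: P_def span_base)
    then have mP: "m \<in> P"
      using subP by (simp add: m_def subspace_scale inversion_mem_subspace)
    have "m \<noteq> 0" using False by (simp add: m_def inversion_def)
    have "pairwise orthogonal {foot, u}"
      using perp by (auto simp: pairwise_def orthogonal_def inner_commute)
    then have "independent {foot, u}"
      using False \<open>u \<noteq> 0\<close> by (intro pairwise_orthogonal_independent) auto
    moreover have "foot \<noteq> u" using perp False by auto
    ultimately have "dim P = 2"
      by (simp add: P_def dim_span dim_eq_card_independent)
    then have "aff_dim P = 2" using subP by (simp add: aff_dim_subspace)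
    then have "is_circle {x \<in> P. dist m x = norm m}"
      unfolding is_circle_def using subP mP \<open>m \<noteq> 0\<close> subspace_imp_affine zero_less_norm_iff by blast
    moreover have "inversion y \<in> P \<and> dist m (inversion y) = norm m" if y: "y \<in> T" for y
    proof -
      obtain t where t: "y = foot + t *\<^sub>R u" using T[OF y] by blast
      have "foot \<bullet> y = foot \<bullet> foot"
        using perp by (simp add: t inner_add_right)
      then have "m \<bullet> y = 1 / 2" "y \<noteq> 0"
        using False by (auto simp: m_def inversion_def)
      moreover from \<open>y \<noteq> 0\<close> have "inversion y \<noteq> 0"
        by (simp add: inversion_def)
      moreover have "y \<in> P"
        using subP \<open>foot \<in> P\<close> \<open>u \<in> P\<close> by (simp add: t subspace_add subspace_scale)
      ultimately show ?thesis
        using subP by (simp add: dist_eq_norm_iff_inner_inversion inversion_mem_subspace)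
    qed
    ultimately show ?thesis
      using subspace_0[OF subP]
      by (intro exI[of _ "{x \<in> P. dist m x = norm m}"]) auto
  qed
qed

lemma circle_or_line_iff_collinear_inversion:
  fixes S :: "'a::euclidean_space set"
  assumes "0 \<notin> S" and ab: "a \<in> S" "b \<in> S" "a \<noteq> b"
  shows "(\<exists>C. (is_circle C \<or> is_line C) \<and> insert 0 S \<subseteq> C) \<longleftrightarrow> collinear (inversion ` S)"
proof
  assume "\<exists>C. (is_circle C \<or> is_line C) \<and> insert 0 S \<subseteq> C"
  then obtain C where C: "is_circle C \<or> is_line C" "0 \<in> C" "S \<subseteq> C" by blast
  then have "collinear (inversion ` (C - {0}))"
    using collinear_inversion_circle collinear_inversion_line
    by (metis collinear_subset Diff_subset image_mono)
  moreover have "inversion ` S \<subseteq> inversion ` (C - {0})"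
    using C(3) \<open>0 \<notin> S\<close> by blast
  ultimately show "collinear (inversion ` S)"
    using collinear_subset by blast
next
  assume "collinear (inversion ` S)"
  moreover have "inversion a \<noteq> inversion b"
    using ab(3) by (metis inversion_inversion)
  ultimately have "\<exists>C. (is_circle C \<or> is_line C) \<and> insert 0 (inversion ` inversion ` S) \<subseteq> C"
    using ab(1,2) by (intro inversion_collinear_subset_circle_or_line) auto
  then show "\<exists>C. (is_circle C \<or> is_line C) \<and> insert 0 S \<subseteq> C"
    by (simp add: image_image)
qed

section \<open>Translations\<close>

lemma is_line_translation: "is_line L \<Longrightarrow> is_line ((+) d ` L)"
  by (simp add: is_line_def aff_dim_translation_eq flip: affine_translation)

lemma is_circle_translation:
  assumes "is_circle C"
  shows "is_circle ((+) d ` C)"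
proof -
  obtain P c r where P: "affine P" "aff_dim P = 2" "c \<in> P" "0 < r"
    and C: "C = {x \<in> P. dist c x = r}"
    using assms unfolding is_circle_def by blast
  have "affine ((+) d ` P)" "aff_dim ((+) d ` P) = 2" "d + c \<in> (+) d ` P"
    using P by (simp_all add: aff_dim_translation_eq flip: affine_translation)
  moreover have "(+) d ` C = {x \<in> (+) d ` P. dist (d + c) x = r}"
    unfolding C by auto
  ultimately show ?thesis
    unfolding is_circle_def using \<open>0 < r\<close> by blast
qed

lemma circle_or_line_translation:
  "(\<exists>C. (is_circle C \<or> is_line C) \<and> (+) d ` S \<subseteq> C)
    \<longleftrightarrow> (\<exists>C. (is_circle C \<or> is_line C) \<and> S \<subseteq> C)"
    (is "?L \<longleftrightarrow> ?R")
proof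
  assume ?L
  then obtain C where C: "is_circle C \<or> is_line C" "(+) d ` S \<subseteq> C" by blast
  have "S = (+) (- d) ` (+) d ` S" by (simp add: image_image)
  also have "\<dots> \<subseteq> (+) (- d) ` C" using C(2) by blast
  finally show ?R
    using C(1) is_circle_translation is_line_translation by blast
next
  assume ?R
  then obtain C where "is_circle C \<or> is_line C" "S \<subseteq> C" by blast
  then show ?L
    using is_circle_translation is_line_translation by (meson image_mono)
qed

section \<open>Quaternionic inverses and the cross-ratio\<close>

definition cnj_quat :: "quat \<Rightarrow> quat" where
  "cnj_quat q = Quat (qre q) (- qim1 q) (- qim2 q) (- qim3 q)"

lemma linear_cnj_quat: "linear cnj_quat"
  by (rule linearI) (simp_all add: cnj_quat_def plus_quat_def scaleR_quat_def)

lemma cnj_quat_cnj_quat [simp]: "cnj_quat (cnj_quat q) = q"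
  by (simp add: cnj_quat_def)

lemma inverse_quat_eq_cnj_inversion: "inverse q = cnj_quat (inversion q)"
  by (simp add: inverse_quat_def inversion_def cnj_quat_def scaleR_quat_def)

lemma collinear_linear_image:
  assumes "linear f" "collinear S"
  shows "collinear (f ` S)"
proof -
  obtain u where u: "\<And>x y. x \<in> S \<Longrightarrow> y \<in> S \<Longrightarrow> \<exists>t. x - y = t *\<^sub>R u"
    using assms(2) unfolding collinear_def by blast
  have "\<exists>t. f x - f y = t *\<^sub>R f u" if "x \<in> S" "y \<in> S" for x y
    using u[OF that] by (metis linear_diff[OF assms(1)] linear_scale[OF assms(1)])
  then show ?thesis unfolding collinear_def by blast
qed

lemma collinear_inverse_iff_collinear_inversion:
  fixes S :: "quat set"
  shows "collinear (inverse ` S) \<longleftrightarrow> collinear (inversion ` S)"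
proof -
  have "inverse ` S = cnj_quat ` inversion ` S" "inversion ` S = cnj_quat ` inverse ` S"
    by (simp_all add: image_image inverse_quat_eq_cnj_inversion)
  then show ?thesis
    using collinear_linear_image[OF linear_cnj_quat] by metis
qed

text \<open>This reads the quotient of two differences \<open>p - r\<close> and \<open>q - r\<close> as a test for the
  collinearity of \<open>p\<close>, \<open>q\<close> and \<open>r\<close>.\<close>

lemma mult_inverse_Reals_iff_collinear:
  fixes x y :: "'a::{real_normed_div_algebra, euclidean_space}"
  assumes "y \<noteq> 0"
  shows "x * inverse y \<in> \<real> \<longleftrightarrow> collinear {0, y, x}"
proof -
  have "x * inverse y = of_real t \<longleftrightarrow> x = t *\<^sub>R y" for t
  proof
    assume "x * inverse y = of_real t"
    then have "x * inverse y * y = of_real t * y" by simp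
    then show "x = t *\<^sub>R y" using assms by (simp add: mult.assoc scaleR_conv_of_real)
  qed (use assms in \<open>simp add: scaleR_conv_of_real mult.assoc\<close>)
  then have "x * inverse y \<in> \<real> \<longleftrightarrow> (\<exists>t. x = t *\<^sub>R y)"
    by (auto simp: Reals_def image_iff)
  also have "\<dots> \<longleftrightarrow> collinear {0, y, x}"
    using assms by (auto simp: collinear_lemma intro: exI[of _ 0])
  finally show ?thesis .
qed

lemma conjugate_Reals_iff:
  fixes c x :: "'a::real_normed_div_algebra"
  assumes "c \<noteq> 0"
  shows "c * x * inverse c \<in> \<real> \<longleftrightarrow> x \<in> \<real>"
proof
  assume "c * x * inverse c \<in> \<real>"
  then obtain t where "c * x * inverse c = of_real t" by (elim Reals_cases)
  then have "inverse c * (c * x * inverse c) * c = inverse c * of_real t * c" by simp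
  moreover have "inverse c * (c * x * inverse c) * c = (inverse c * c) * x * (inverse c * c)"
    by (simp only: mult.assoc)
  moreover have "inverse c * of_real t * c = of_real t"
    using assms by (simp add: of_real_def)
  ultimately show "x \<in> \<real>" using assms by simp
next
  assume "x \<in> \<real>"
  then obtain t where "x = of_real t" by (elim Reals_cases)
  then have "c * x * inverse c = of_real t"
    using assms by (simp add: of_real_def)
  then show "c * x * inverse c \<in> \<real>" by simp
qed

lemma cross_ratio_real_iff_collinear_inverses:
  fixes a b c :: quat
  assumes "a \<noteq> 0" "b \<noteq> 0" "c \<noteq> 0" "b \<noteq> c"
  shows "cross_ratio a b c 0 \<in> \<real> \<longleftrightarrow> collinear {inverse a, inverse b, inverse c}"
proof -
  define u v where "u = inverse a - inverse c" and "v = inverse b - inverse c"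
  have "v \<noteq> 0"
    using assms by (simp add: v_def)
  have u: "(a - c) * inverse a = - (c * u)"
    using assms by (simp add: u_def algebra_simps)
  have "b - c = - (c * v * b)"
    using assms by (simp add: v_def algebra_simps)
  then have v: "b * inverse (b - c) = - (inverse v * inverse c)"
    using assms \<open>v \<noteq> 0\<close> by (simp add: nonzero_inverse_mult_distrib flip: mult.assoc)
  have "cross_ratio a b c 0 = ((a - c) * inverse a) * (b * inverse (b - c))"
    by (simp add: cross_ratio_def mult.assoc)
  also have "\<dots> = c * (u * inverse v) * inverse c"
    by (simp add: u v mult.assoc)
  finally have "cross_ratio a b c 0 \<in> \<real> \<longleftrightarrow> u * inverse v \<in> \<real>"
    using conjugate_Reals_iff[OF \<open>c \<noteq> 0\<close>] by simp
  also have "\<dots> \<longleftrightarrow> collinear {0, v, u}"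
    by (rule mult_inverse_Reals_iff_collinear[OF \<open>v \<noteq> 0\<close>])
  also have "\<dots> \<longleftrightarrow> collinear {inverse a, inverse b, inverse c}"
    using collinear_3[of "inverse b" "inverse c" "inverse a"]
    by (simp add: u_def v_def insert_commute)
  finally show ?thesis .
qed

lemma cross_ratio_translation:
  "cross_ratio (q1 - d) (q2 - d) (q3 - d) (q4 - d) = cross_ratio q1 q2 q3 q4"
  by (simp add: cross_ratio_def)

theorem proposition1p4:
  fixes q1 q2 q3 q4 :: quat
  assumes "distinct [q1, q2, q3, q4]"
  shows "(\<exists>C. (is_circle C \<or> is_line C) \<and> {q1, q2, q3, q4} \<subseteq> C)
    \<longleftrightarrow> cross_ratio q1 q2 q3 q4 \<in> \<real>"
proof -
  define a b c where "a = q1 - q4" and "b = q2 - q4" and "c = q3 - q4"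
  have nz: "a \<noteq> 0" "b \<noteq> 0" "c \<noteq> 0" and ne: "a \<noteq> b" "b \<noteq> c"
    using assms by (auto simp: a_def b_def c_def)
  have "{q1, q2, q3, q4} = (+) q4 ` insert 0 {a, b, c}"
    by (auto simp: a_def b_def c_def)
  then have "(\<exists>C. (is_circle C \<or> is_line C) \<and> {q1, q2, q3, q4} \<subseteq> C)
      \<longleftrightarrow> (\<exists>C. (is_circle C \<or> is_line C) \<and> insert 0 {a, b, c} \<subseteq> C)"
    by (simp only: circle_or_line_translation)
  also have "\<dots> \<longleftrightarrow> collinear (inversion ` {a, b, c})"
    by (rule circle_or_line_iff_collinear_inversion[of _ a b]) (use nz ne in auto)
  also have "\<dots> \<longleftrightarrow> collinear {inverse a, inverse b, inverse c}"
    using collinear_inverse_iff_collinear_inversion[of "{a, b, c}"] by simp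
  also have "\<dots> \<longleftrightarrow> cross_ratio a b c 0 \<in> \<real>"
    using nz ne(2) by (simp add: cross_ratio_real_iff_collinear_inverses)
  also have "cross_ratio a b c 0 = cross_ratio q1 q2 q3 q4"
    using cross_ratio_translation[of q1 q4 q2 q3 q4] by (simp add: a_def b_def c_def)
  finally show ?thesis .
qed

end
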